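(* Let $p$ be an odd prime. Then $$\sum_{k=0}^{[\frac{p-1}8]}\frac{\binom{8k}{4k}}{4^{4k-1}}\equiv\begin{cases}1+(-1)^{\frac{p-1}8}2^{\frac{p+3}4}\pmod p&\text{if }p\equiv1\pmod8,\\ -1+(-1)^{\frac{p-3}8}2^{\frac{p+1}4}\pmod p&\text{if }p\equiv3\pmod8,\\ -1\pmod p&\text{if }p\equiv5\pmod8,\\ 1-(-1)^{\frac{p-7}8}2^{\frac{p+1}4}\pmod p&\text{if }p\equiv7\pmod8.\end{cases}$$
   Context: $[x]$ is the greatest integer not exceeding $x$. *)

theory Defs
  imports Complex_Main "HOL-Computational_Algebra.Primes"
begin

text \<open>Congruence of rational numbers modulo \<open>m\<close>: the difference is \<open>m\<close> times a fraction
  whose denominator is coprime to \<open>m\<close>. For prime \<open>m\<close> this is congruence modulo \<open>m\<close> in the ring of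
  \<open>m\<close>-integral rationals; on integers it agrees with the usual congruence.\<close>

definition rat_cong :: "rat \<Rightarrow> rat \<Rightarrow> nat \<Rightarrow> bool"  (\<open>(1[_ \<equiv> _] '(ratmod _'))\<close>) where
  "[x \<equiv> y] (ratmod m) \<longleftrightarrow>
     (\<exists>a b :: int. coprime b (int m) \<and> b \<noteq> 0 \<and> x - y = of_nat m * (of_int a / of_int b))"

end

theory Submission
  imports Defs "HOL-Number_Theory.Cong"
begin

text \<open>Write \<open>n = (p - 1) / 2\<close>. Since \<open>n \<equiv> -1/2\<close> modulo \<open>p\<close>, the quotient
  \<open>binom(2m, m) / 4^m\<close> is congruent to \<open>(-1)^m binom(n, m)\<close> for \<open>m < p\<close>. Hence the sum is
  congruent to four times the sum of the \<open>binom(n, j)\<close> with \<open>4\<close> dividing \<open>j\<close>, which the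
  roots-of-unity filter evaluates as \<open>2^n + 2 Re ((1 + i)^n)\<close>. The value of \<open>2^n\<close> modulo \<open>p\<close>
  follows by comparing real parts in \<open>(1 + i)^p \<equiv> 1 + i^p\<close>, as \<open>(1 + i)^p = (2i)^n (1 + i)\<close>.\<close>

section \<open>Congruences between rationals modulo \<open>m\<close>\<close>

lemma rat_cong_of_int:
  assumes "[a = b] (mod int m)"
  shows "[of_int a \<equiv> of_int b] (ratmod m)"
proof -
  obtain d where d: "a - b = int m * d"
    using assms by (auto simp: cong_iff_dvd_diff elim: dvdE)
  have "of_int a - of_int b = (of_int (a - b) :: rat)" by simp
  also have "\<dots> = of_nat m * (of_int d / of_int 1)" unfolding d by simp
  finally show ?thesis
    unfolding rat_cong_def by (intro exI[of _ d] exI[of _ 1]) simp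
qed

text \<open>The difference \<open>a / c - b\<close> equals \<open>(a - b * c) / c\<close>, so
  \<open>c\<close> itself serves as the denominator prime to \<open>m\<close>. This replaces each
  fraction in the sum by an integer.\<close>

lemma rat_cong_divide:
  assumes "[a = b * c] (mod int m)" and "coprime c (int m)" and "c \<noteq> 0"
  shows "[of_int a / of_int c \<equiv> of_int b] (ratmod m)"
proof -
  obtain d where d: "a - b * c = int m * d"
    using assms(1) by (auto simp: cong_iff_dvd_diff elim: dvdE)
  have "of_int a / of_int c - of_int b = (of_int (a - b * c) / of_int c :: rat)"
    using assms(3) by (simp add: field_simps)
  also have "\<dots> = of_nat m * (of_int d / of_int c)" unfolding d by simp
  finally show ?thesis
    unfolding rat_cong_def using assms(2,3) by blast
qed

lemma rat_cong_add:
  assumes "[x \<equiv> y] (ratmod m)" and "[z \<equiv> w] (ratmod m)"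
  shows "[x + z \<equiv> y + w] (ratmod m)"
proof -
  obtain a b c d :: int where ab: "coprime b (int m)" "b \<noteq> 0"
      "x - y = of_nat m * (of_int a / of_int b)"
    and cd: "coprime d (int m)" "d \<noteq> 0" "z - w = of_nat m * (of_int c / of_int d)"
    using assms unfolding rat_cong_def by blast
  have "x + z - (y + w) = (x - y) + (z - w)" by simp
  also have "\<dots> = of_nat m * (of_int (a * d + c * b) / of_int (b * d))"
    unfolding ab cd using ab(2) cd(2) by (simp add: field_simps)
  finally show ?thesis
    unfolding rat_cong_def using ab cd
    by (intro exI[of _ "a * d + c * b"] exI[of _ "b * d"]) simp
qed

text \<open>Adding the two congruences puts \<open>y\<close> on both sides, and it cancels in the
  difference.\<close>

lemma rat_cong_trans:
  assumes "[x \<equiv> y] (ratmod m)" and "[y \<equiv> z] (ratmod m)"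
  shows "[x \<equiv> z] (ratmod m)"
  using rat_cong_add[OF assms] unfolding rat_cong_def by simp

lemma rat_cong_sum:
  assumes "\<And>k. k \<in> A \<Longrightarrow> [f k \<equiv> g k] (ratmod m)"
  shows "[sum f A \<equiv> sum g A] (ratmod m)"
proof -
  have zero: "[0 \<equiv> 0] (ratmod m)"
    using rat_cong_of_int[of 0 0 m] by simp
  show ?thesis
    using assms by (induction A rule: infinite_finite_induct) (auto simp: zero intro: rat_cong_add)
qed

section \<open>Central binomial coefficients modulo \<open>p\<close>\<close>

lemma central_binomial_Suc:
  "Suc m * (2 * Suc m choose Suc m) = 2 * (2 * m + 1) * (2 * m choose m)"
proof -
  have double: "2 * Suc m = Suc (Suc (2 * m))" by simp
  have "Suc m * (2 * Suc m choose Suc m) = 2 * Suc m * (Suc (2 * m) choose m)"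
    unfolding double by (metis Suc_times_binomial_eq mult.commute)
  also have "Suc (2 * m) choose m = Suc (2 * m) choose Suc m"
    using binomial_symmetric[of m "Suc (2 * m)"] by simp
  also have "2 * Suc m * (Suc (2 * m) choose Suc m) = 2 * (Suc (2 * m) * (2 * m choose m))"
    unfolding Suc_times_binomial_eq by (simp only: ac_simps)
  finally show ?thesis by simp
qed

text \<open>Both sides agree at \<open>m = 0\<close> and obey first-order recurrences in
  \<open>m\<close>. After multiplication by \<open>m + 1\<close> the factors are
  \<open>2 * (2 * m + 1)\<close> and \<open>-4 * (n - m)\<close>, which differ by
  \<open>2 * p\<close>. The bound \<open>m < p\<close> keeps \<open>m + 1\<close> invertible at
  every step.\<close>

lemma central_binomial_cong:
  assumes "prime p" and "p = 2 * n + 1" and "m < p"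
  shows "[int (2 * m choose m) = (-1) ^ m * int (n choose m) * 4 ^ m] (mod int p)"
  using assms(3)
proof (induction m)
  case 0
  then show ?case by simp
next
  case (Suc m)
  \<comment> \<open>Subtraction in the integers lets this cover \<open>m > n\<close> too, where both
    binomials vanish.\<close>
  have absorb: "int (Suc m) * int (n choose Suc m) = (int n - int m) * int (n choose m)"
  proof (cases "m \<le> n")
    case True
    then have "Suc m * (n choose Suc m) = (n - m) * (n choose m)"
      by (simp only: binomial_absorb_comp binomial_absorption)
    then show ?thesis using True by (metis of_nat_diff of_nat_mult)
  qed (simp add: binomial_eq_0)
  have "int (Suc m) * int (2 * Suc m choose Suc m) = 2 * (2 * int m + 1) * int (2 * m choose m)"
    using central_binomial_Suc[of m] by (metis (no_types, lifting) of_nat_1 of_nat_add of_nat_mult of_nat_numeral)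
  also have "[\<dots> = (2 * (2 * int m + 1)) * ((-1) ^ m * int (n choose m) * 4 ^ m)] (mod int p)"
    using Suc by (intro cong_mult) auto
  also have "[(2 * (2 * int m + 1)) * ((-1) ^ m * int (n choose m) * 4 ^ m)
       = (2 * (2 * int m + 1) - 2 * int p) * ((-1) ^ m * int (n choose m) * 4 ^ m)] (mod int p)"
    by (intro cong_mult) (auto simp: cong_iff_dvd_diff)
  also have "2 * (2 * int m + 1) - 2 * int p = - 4 * (int n - int m)"
    using assms(2) by simp
  also have "- 4 * (int n - int m) * ((-1) ^ m * int (n choose m) * 4 ^ m)
       = (-1) ^ Suc m * ((int n - int m) * int (n choose m)) * 4 ^ Suc m"
    by (simp add: algebra_simps)
  also have "\<dots> = int (Suc m) * ((-1) ^ Suc m * int (n choose Suc m) * 4 ^ Suc m)"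
    unfolding absorb[symmetric] by simp
  finally have "[int (Suc m) * int (2 * Suc m choose Suc m)
      = int (Suc m) * ((-1) ^ Suc m * int (n choose Suc m) * 4 ^ Suc m)] (mod int p)" .
  moreover have "coprime (int (Suc m)) (int p)"
  proof -
    have "\<not> p dvd Suc m" using Suc.prems by (auto dest: dvd_imp_le)
    then have "coprime p (Suc m)" using assms(1) by (rule prime_imp_coprime[rotated])
    then show ?thesis by (simp add: coprime_commute del: of_nat_Suc)
  qed
  ultimately show ?case by (metis cong_mult_lcancel)
qed

section \<open>Powers of \<open>1 + i\<close> and binomial sums\<close>

definition re_ii_pow :: "nat \<Rightarrow> int" where
  "re_ii_pow j = (if j mod 4 = 0 then 1 else if j mod 4 = 2 then -1 else 0)"

lemma ii_power_add_four_mult: "\<i> ^ (4 * q + r) = \<i> ^ r"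
  by (simp add: power_add power_mult)

lemma Re_ii_power: "Re (\<i> ^ j) = of_int (re_ii_pow j)"
proof -
  have "\<i> ^ j = \<i> ^ (4 * (j div 4) + j mod 4)" by simp
  also have "\<dots> = \<i> ^ (j mod 4)" by (rule ii_power_add_four_mult)
  finally have *: "\<i> ^ j = \<i> ^ (j mod 4)" .
  have "j mod 4 \<in> {0, 1, 2, 3}" by auto
  then show ?thesis
    unfolding * re_ii_pow_def by (auto simp: power_numeral_reduce)
qed

text \<open>An integer form of the real part of \<open>(1 + i) ^ n\<close>: as a binomial sum it can
  be reduced modulo \<open>p\<close>, while its closed form comes from complex arithmetic.\<close>

definition re_one_plus_ii_pow :: "nat \<Rightarrow> int" where
  "re_one_plus_ii_pow n = (\<Sum>j\<le>n. int (n choose j) * re_ii_pow j)"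

lemma Re_one_plus_ii_power:
  "Re ((1 + \<i>) ^ n) = of_int (re_one_plus_ii_pow n)"
proof -
  have "(1 + \<i>) ^ n = (\<Sum>j\<le>n. of_nat (n choose j) * \<i> ^ j)"
    using binomial_ring[of \<i> 1 n] by (simp add: add.commute)
  then have "Re ((1 + \<i>) ^ n) = (\<Sum>j\<le>n. Re (of_nat (n choose j) * \<i> ^ j))"
    by simp
  also have "\<dots> = (\<Sum>j\<le>n. real (n choose j) * of_int (re_ii_pow j))"
    by (simp add: Re_ii_power)
  finally show ?thesis by (simp add: re_one_plus_ii_pow_def)
qed

text \<open>The fourth roots of unity satisfy \<open>1 + (-1)^j + i^j + (-i)^j = 4\<close> if 4
  divides \<open>j\<close>, and 0 otherwise; the last two summands are conjugate and give
  \<open>2 * re_ii_pow j\<close>. Positivity of \<open>n\<close> makes the alternating binomial sum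
  vanish.\<close>

lemma sum_binomial_four_dvd:
  assumes "n > 0"
  shows "4 * (\<Sum>k = 0..n div 4. int (n choose (4 * k)))
       = 2 ^ n + 2 * re_one_plus_ii_pow n"
proof -
  have "4 * (\<Sum>k = 0..n div 4. int (n choose (4 * k)))
      = 4 * (\<Sum>j\<in>(\<lambda>k. 4 * k) ` {0..n div 4}. int (n choose j))"
    by (subst sum.reindex) (auto simp: inj_on_def)
  also have "(\<lambda>k. 4 * k) ` {0..n div 4} = {j \<in> {..n}. 4 dvd j}"
    by (auto simp: dvd_def)
  also have "4 * (\<Sum>j\<in>{j \<in> {..n}. 4 dvd j}. int (n choose j))
      = (\<Sum>j\<le>n. int (n choose j) * (if 4 dvd j then 4 else 0))"
    by (subst sum.inter_filter)
      (auto simp: sum_distrib_left mult.commute intro!: sum.cong)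
  also have "\<dots> = (\<Sum>j\<le>n. int (n choose j) + (-1) ^ j * int (n choose j)
                     + 2 * (int (n choose j) * re_ii_pow j))"
  proof (rule sum.cong)
    fix j
    have "(if 4 dvd j then 4 else 0) = 1 + (-1) ^ j + 2 * re_ii_pow j"
      unfolding re_ii_pow_def minus_one_power_iff by auto presburger+
    then show "int (n choose j) * (if 4 dvd j then 4 else 0)
        = int (n choose j) + (-1) ^ j * int (n choose j) + 2 * (int (n choose j) * re_ii_pow j)"
      by (simp only:) (simp add: algebra_simps)
  qed simp
  also have "\<dots> = (\<Sum>j\<le>n. int (n choose j)) + (\<Sum>j\<le>n. (-1) ^ j * int (n choose j))
                  + 2 * re_one_plus_ii_pow n"
    by (simp add: sum.distrib sum_distrib_left re_one_plus_ii_pow_def)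
  also have "(\<Sum>j\<le>n. (-1) ^ j * int (n choose j)) = 0"
    using choose_alternating_sum[OF assms, where 'a = int] by simp
  also have "(\<Sum>j\<le>n. int (n choose j)) = 2 ^ n"
    using choose_row_sum[of n] by (metis of_nat_numeral of_nat_power of_nat_sum)
  finally show ?thesis by simp
qed

text \<open>Since \<open>(1 + i)^4 = -4\<close> is real, it factors out of the real part, leaving
  those of 1, \<open>1 + i\<close>, \<open>2i\<close> and \<open>-2 + 2i\<close>.\<close>

lemma re_one_plus_ii_pow_mod_four:
  "re_one_plus_ii_pow (4 * q) = (-4) ^ q"
  "re_one_plus_ii_pow (4 * q + 1) = (-4) ^ q"
  "re_one_plus_ii_pow (4 * q + 2) = 0"
  "re_one_plus_ii_pow (4 * q + 3) = - 2 * (-4) ^ q"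
proof -
  have four: "(1 + \<i>) ^ 4 = of_real (-4)"
    by (simp add: power_numeral_reduce algebra_simps complex_eq_iff)
  have split: "Re ((1 + \<i>) ^ (4 * q + r)) = (-4) ^ q * Re ((1 + \<i>) ^ r)" for r
    unfolding power_add power_mult four of_real_power[symmetric] by simp
  have small: "Re ((1 + \<i>) ^ 0) = 1" "Re ((1 + \<i>) ^ 1) = 1" "Re ((1 + \<i>) ^ 2) = 0"
    "Re ((1 + \<i>) ^ 3) = - 2"
    by (simp_all add: power_numeral_reduce)
  have transfer: "re_one_plus_ii_pow (4 * q + r) = (-4) ^ q * c"
    if "Re ((1 + \<i>) ^ r) = of_int c" for r c
  proof -
    have "real_of_int (re_one_plus_ii_pow (4 * q + r)) = of_int ((-4) ^ q * c)"
      unfolding Re_one_plus_ii_power[symmetric] split that by simp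
    then show ?thesis by (simp only: of_int_eq_iff)
  qed
  show "re_one_plus_ii_pow (4 * q) = (-4) ^ q"
    "re_one_plus_ii_pow (4 * q + 1) = (-4) ^ q"
    "re_one_plus_ii_pow (4 * q + 2) = 0"
    "re_one_plus_ii_pow (4 * q + 3) = - 2 * (-4) ^ q"
    using transfer[of 0 1] transfer[of 1 1] transfer[of 2 0] transfer[of 3 "-2"] small
    by simp_all
qed

section \<open>The power \<open>2 ^ ((p - 1) / 2)\<close> modulo \<open>p\<close>\<close>

text \<open>The inner binomials are divisible by \<open>p\<close>, and \<open>i^p\<close> is purely
  imaginary for odd \<open>p\<close>, so only the term \<open>j = 0\<close> survives.\<close>

lemma Re_one_plus_ii_power_prime_cong:
  assumes "prime p" and "odd p"
  shows "[re_one_plus_ii_pow p = 1] (mod int p)"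
proof -
  have "[(\<Sum>j\<le>p. int (p choose j) * re_ii_pow j) = (\<Sum>j\<le>p. if j = 0 then 1 else 0)] (mod int p)"
  proof (rule cong_sum)
    fix j assume "j \<in> {..p}"
    then consider "j = 0" | "j = p" "j \<noteq> 0" | "0 < j" "j < p" by fastforce
    then show "[int (p choose j) * re_ii_pow j = (if j = 0 then 1 else 0)] (mod int p)"
    proof cases
      case 1
      then show ?thesis by (simp add: re_ii_pow_def)
    next
      case 2
      have "re_ii_pow p = 0"
        using assms(2) unfolding re_ii_pow_def by presburger
      then show ?thesis using 2 by simp
    next
      case 3
      then have "p dvd (p choose j)"
        using assms(1) by (intro dvd_choose_prime) auto
      then show ?thesis using 3 by (simp add: cong_0_iff)
    qed
  qed
  then show ?thesis by (simp add: re_one_plus_ii_pow_def)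
qed

text \<open>Each exponent is \<open>(p - 1) / 2\<close>. The closed form of
  \<open>re_one_plus_ii_pow p\<close> is plus or minus this power of 2, and it is congruent to 1, so
  the sign decides the residue.\<close>

lemma two_power_half_cong:
  assumes "prime p"
  shows "p = 8 * m + 1 \<Longrightarrow> [2 ^ (4 * m) = 1] (mod int p)"
    and "p = 8 * m + 3 \<Longrightarrow> [2 ^ (4 * m + 1) = - 1] (mod int p)"
    and "p = 8 * m + 5 \<Longrightarrow> [2 ^ (4 * m + 2) = - 1] (mod int p)"
    and "p = 8 * m + 7 \<Longrightarrow> [2 ^ (4 * m + 3) = 1] (mod int p)"
proof -
  have R: "[re_one_plus_ii_pow p = 1] (mod int p)" if "odd p"
    using assms that by (rule Re_one_plus_ii_power_prime_cong)
  have even_pow: "(-4 :: int) ^ (2 * m) = 2 ^ (4 * m)"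
    by (simp add: power_mult)
  have neg: "[x = - 1] (mod int p)" if "[- x = 1] (mod int p)" for x
    using that by (metis cong_minus_minus_iff minus_minus)
  show "[2 ^ (4 * m) = 1] (mod int p)" if p: "p = 8 * m + 1"
  proof -
    have "re_one_plus_ii_pow p = 2 ^ (4 * m)"
      using re_one_plus_ii_pow_mod_four(2)[of "2 * m"] unfolding even_pow by (simp add: p)
    then show ?thesis using R p by simp
  qed
  show "[2 ^ (4 * m + 1) = - 1] (mod int p)" if p: "p = 8 * m + 3"
  proof -
    have "re_one_plus_ii_pow p = - (2 ^ (4 * m + 1))"
      using re_one_plus_ii_pow_mod_four(4)[of "2 * m"] unfolding even_pow by (simp add: p)
    then show ?thesis using R p by (intro neg) simp
  qed
  show "[2 ^ (4 * m + 2) = - 1] (mod int p)" if p: "p = 8 * m + 5"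
  proof -
    have "re_one_plus_ii_pow p = - (2 ^ (4 * m + 2))"
      \<comment> \<open>Here \<open>p = 4 * (2 * m + 1) + 1\<close>; the odd exponent of
        \<open>-4\<close> brings in the minus sign.\<close>
      using re_one_plus_ii_pow_mod_four(2)[of "2 * m + 1"]
      unfolding power_add even_pow by (simp add: p add.commute)
    then show ?thesis using R p by (intro neg) simp
  qed
  show "[2 ^ (4 * m + 3) = 1] (mod int p)" if p: "p = 8 * m + 7"
  proof -
    have "re_one_plus_ii_pow p = 2 ^ (4 * m + 3)"
      using re_one_plus_ii_pow_mod_four(4)[of "2 * m + 1"]
      unfolding power_add even_pow by (simp add: p add.commute)
    then show ?thesis using R p by simp
  qed
qed

section \<open>Evaluation of the sum\<close>

theorem theorem4p2:
  fixes p :: nat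
  assumes "prime p" and "odd p"
  defines "S \<equiv> (\<Sum>k = 0..(p - 1) div 8.
                  of_nat ((8 * k) choose (4 * k)) / (4 :: rat) powi (4 * int k - 1))"
  shows "(p mod 8 = 1 \<longrightarrow>
            [S \<equiv> 1 + (-1) ^ ((p - 1) div 8) * 2 ^ ((p + 3) div 4)] (ratmod p)) \<and>
         (p mod 8 = 3 \<longrightarrow>
            [S \<equiv> - 1 + (-1) ^ ((p - 3) div 8) * 2 ^ ((p + 1) div 4)] (ratmod p)) \<and>
         (p mod 8 = 5 \<longrightarrow> [S \<equiv> - 1] (ratmod p)) \<and>
         (p mod 8 = 7 \<longrightarrow>
            [S \<equiv> 1 - (-1) ^ ((p - 7) div 8) * 2 ^ ((p + 1) div 4)] (ratmod p))"
proof -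
  define n where "n = (p - 1) div 2"
  define R where "R = re_one_plus_ii_pow n"
  have pn: "p = 2 * n + 1" unfolding n_def using assms(2) by presburger
  have "n > 0" using pn prime_gt_1_nat[OF assms(1)] by simp
  have cop: "coprime (256 ^ k) (int p)" for k
  proof -
    have "coprime 2 (int p)" using assms(2) by simp
    then have "coprime (2 ^ (8 * k)) (int p)" by simp
    then show ?thesis by (simp add: power_mult)
  qed
  \<comment> \<open>The exponent is \<open>-1\<close> at \<open>k = 0\<close>. Moving the factor 4
    to the numerator leaves the integer denominator \<open>4 ^ (4 * k) = 256 ^ k\<close>.\<close>
  have term_eq: "of_nat ((8 * k) choose (4 * k)) / (4 :: rat) powi (4 * int k - 1)
      = of_int (4 * int ((8 * k) choose (4 * k))) / of_int (256 ^ k)" for k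
  proof -
    have "(4 :: rat) powi (4 * int k - 1) = 4 powi int (4 * k) / 4"
      by (simp add: power_int_diff)
    also have "\<dots> = 256 ^ k / 4"
      by (simp only: power_int_of_nat power_mult) simp
    finally show ?thesis by (simp only:) simp
  qed
  have "[S \<equiv> (\<Sum>k = 0..(p - 1) div 8. of_int (4 * int (n choose (4 * k))))] (ratmod p)"
    unfolding S_def term_eq
  proof (intro rat_cong_sum rat_cong_divide cop)
    fix k assume "k \<in> {0..(p - 1) div 8}"
    then have "4 * k < p" using pn by auto
    then have "[int (2 * (4 * k) choose (4 * k))
        = (-1) ^ (4 * k) * int (n choose (4 * k)) * 4 ^ (4 * k)] (mod int p)"
      by (rule central_binomial_cong[OF assms(1) pn])
    then have "[int (8 * k choose (4 * k)) = int (n choose (4 * k)) * 256 ^ k] (mod int p)"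
      by (simp add: power_mult)
    from cong_scalar_left[OF this, of 4]
    show "[4 * int (8 * k choose (4 * k)) = 4 * int (n choose (4 * k)) * 256 ^ k] (mod int p)"
      by (simp add: mult.assoc)
  qed simp
  also have "(\<Sum>k = 0..(p - 1) div 8. of_int (4 * int (n choose (4 * k))))
      = (of_int (4 * (\<Sum>k = 0..n div 4. int (n choose (4 * k)))) :: rat)"
  proof -
    \<comment> \<open>The range of summation thus meets every multiple of 4 up to \<open>n\<close>,
      as the filter requires.\<close>
    have "(p - 1) div 8 = n div 4" using pn by simp
    then show ?thesis by (simp add: sum_distrib_left)
  qed
  also have "\<dots> = of_int (2 ^ n + 2 * R)"
    unfolding R_def sum_binomial_four_dvd[OF \<open>n > 0\<close>] ..
  finally have S: "[S \<equiv> of_int (2 ^ n + 2 * R)] (ratmod p)" .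
  \<comment> \<open>\<open>R\<close> is known exactly, so only \<open>2 ^ n\<close> has to be
    reduced modulo \<open>p\<close>.\<close>
  have reduce: "[S \<equiv> of_int (a + 2 * R)] (ratmod p)" if "[2 ^ n = a] (mod int p)" for a
    using S by (rule rat_cong_trans) (intro rat_cong_of_int cong_add that cong_refl)
  define m where "m = p div 8"
  have pow4: "(-4 :: rat) ^ m = (-1) ^ m * 2 ^ (2 * m)"
    by (simp add: power_mult flip: power_mult_distrib)
  show ?thesis
  \<comment> \<open>For \<open>n = 4 * m + r\<close> with \<open>r = 0, 1, 2, 3\<close>, the term
    \<open>2 * R\<close> is \<open>2 * (-4)^m\<close> in the first two cases, 0 in the third and
    \<open>-4 * (-4)^m\<close> in the last. The exponent of 2 is therefore \<open>2 * m + 1\<close>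
    in the first two cases and \<open>2 * m + 2\<close> in the last.\<close>
  proof (intro conjI impI)
    assume "p mod 8 = 1"
    then have p: "p = 8 * m + 1" and n: "n = 4 * m" unfolding m_def n_def by presburger+
    show "[S \<equiv> 1 + (-1) ^ ((p - 1) div 8) * 2 ^ ((p + 3) div 4)] (ratmod p)"
      using reduce[of 1] two_power_half_cong(1)[OF assms(1) p] re_one_plus_ii_pow_mod_four(1)[of m]
      unfolding n R_def by (simp add: p pow4 mult.left_commute)
  next
    assume "p mod 8 = 3"
    then have p: "p = 8 * m + 3" and n: "n = 4 * m + 1" unfolding m_def n_def by presburger+
    show "[S \<equiv> - 1 + (-1) ^ ((p - 3) div 8) * 2 ^ ((p + 1) div 4)] (ratmod p)"
      using reduce[of "- 1"] two_power_half_cong(2)[OF assms(1) p] re_one_plus_ii_pow_mod_four(2)[of m]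
      unfolding n R_def by (simp add: p pow4 mult.left_commute)
  next
    assume "p mod 8 = 5"
    then have p: "p = 8 * m + 5" and n: "n = 4 * m + 2" unfolding m_def n_def by presburger+
    show "[S \<equiv> - 1] (ratmod p)"
      using reduce[of "- 1"] two_power_half_cong(3)[OF assms(1) p] re_one_plus_ii_pow_mod_four(3)[of m]
      unfolding n R_def by simp
  next
    assume "p mod 8 = 7"
    then have p: "p = 8 * m + 7" and n: "n = 4 * m + 3" unfolding m_def n_def by presburger+
    show "[S \<equiv> 1 - (-1) ^ ((p - 7) div 8) * 2 ^ ((p + 1) div 4)] (ratmod p)"
      using reduce[of 1] two_power_half_cong(4)[OF assms(1) p] re_one_plus_ii_pow_mod_four(4)[of m]
      unfolding n R_def by (simp add: p pow4 mult.left_commute)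
  qed
qed

end
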